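(* (i) For any two channels $W_1:\mathcal{X}_1\to\mathcal{Y}_1$ and $W_2:\mathcal{X}_2\to\mathcal{Y}_2$ with finite output alphabets, $\dot{C}_{\mathrm{DI}}(W_1\times W_2)\ge\dot{C}_{\mathrm{DI}}(W_1)+\dot{C}_{\mathrm{DI}}(W_2)$. (ii) The inequality can be strict; indeed, there exist channels $W_1,W_2$ with finite output alphabets such that $\dot{C}_{\mathrm{DI}}(W_1)=\dot{C}_{\mathrm{DI}}(W_2)=0$ but $\dot{C}_{\mathrm{DI}}(W_1\times W_2)>0$.
   Context: A channel $W:\mathcal{X}\to\mathcal{Y}$ ($\mathcal{X}$ a measurable space, $\mathcal{Y}$ finite) is a measurable map $x\mapsto W_x\in\mathcal{P}(\mathcal{Y})$ to probability distributions on $\mathcal{Y}$; $W_{x^n}(y^n)=\prod_{i=1}^nW_{x_i}(y_i)$. The product channel $W_1\times W_2:\mathcal{X}_1\times\mathcal{X}_2\to\mathcal{Y}_1\times\mathcal{Y}_2$ is given by $(W_1\times W_2)_{(x_1,x_2)}(y_1,y_2)=(W_1)_{x_1}(y_1)(W_2)_{x_2}(y_2)$. An $(n,N,\lambda_1,\lambda_2)$-deterministic identification (DI) code for $W$ is a family $\{(u_j,\mathcal{E}_j):j\in[N]\}$, $u_j\in\mathcal{X}^n$, $\mathcal{E}_j\subset\mathcal{Y}^n$, with $W_{u_j}(\mathcal{E}_j)\ge1-\lambda_1$ for all $j$ and $W_{u_j}(\mathcal{E}_k)\le\lambda_2$ for all $j\neq k$; $N_{\mathrm{DI}}(n,\lambda_1,\lambda_2)$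 is the largest such $N$. Logarithms are base 2, and $\dot{C}_{\mathrm{DI}}(W)=\inf_{\lambda_1,\lambda_2>0}\liminf_{n\to\infty}\frac{1}{n\log n}\log N_{\mathrm{DI}}(n,\lambda_1,\lambda_2)$. *)

theory Defs
  imports "HOL-Analysis.Analysis"
begin

text \<open>A channel W from the measurable space M (input alphabet = space M) to the
finite output alphabet Y: W x y is the probability of output y on input x.
W x is a probability distribution supported on Y, and x \<mapsto> W x is measurable,
i.e. every coordinate x \<mapsto> W x y is Borel measurable.\<close>
definition channel :: "'x measure \<Rightarrow> 'y set \<Rightarrow> ('x \<Rightarrow> 'y \<Rightarrow> real) \<Rightarrow> bool" where
  "channel M Y W \<longleftrightarrow> finite Y \<and> Y \<noteq> {} \<and> space M \<noteq> {} \<and>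
     (\<forall>x\<in>space M. (\<forall>y. 0 \<le> W x y) \<and> (\<forall>y. y \<notin> Y \<longrightarrow> W x y = 0) \<and> sum (W x) Y = 1) \<and>
     (\<forall>y\<in>Y. (\<lambda>x. W x y) \<in> borel_measurable M)"

definition out_words :: "'y set \<Rightarrow> nat \<Rightarrow> (nat \<Rightarrow> 'y) set" where
  "out_words Y n = PiE {..<n} (\<lambda>_. Y)"

definition word_prob :: "('x \<Rightarrow> 'y \<Rightarrow> real) \<Rightarrow> nat \<Rightarrow> (nat \<Rightarrow> 'x) \<Rightarrow> (nat \<Rightarrow> 'y) set \<Rightarrow> real" where
  "word_prob W n u E = (\<Sum>y\<in>E. \<Prod>i<n. W (u i) (y i))"

definition DI_code :: "'x measure \<Rightarrow> 'y set \<Rightarrow> ('x \<Rightarrow> 'y \<Rightarrow> real) \<Rightarrow> nat \<Rightarrow> nat \<Rightarrow> real \<Rightarrow> real \<Rightarrow> bool" where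
  "DI_code M Y W n N l1 l2 \<longleftrightarrow>
     (\<exists>u :: nat \<Rightarrow> nat \<Rightarrow> 'x. \<exists>E :: nat \<Rightarrow> (nat \<Rightarrow> 'y) set.
        (\<forall>j<N. (\<forall>i<n. u j i \<in> space M) \<and> E j \<subseteq> out_words Y n \<and>
                word_prob W n (u j) (E j) \<ge> 1 - l1) \<and>
        (\<forall>j<N. \<forall>k<N. j \<noteq> k \<longrightarrow> word_prob W n (u j) (E k) \<le> l2))"

definition N_DI :: "'x measure \<Rightarrow> 'y set \<Rightarrow> ('x \<Rightarrow> 'y \<Rightarrow> real) \<Rightarrow> nat \<Rightarrow> real \<Rightarrow> real \<Rightarrow> ereal" where
  "N_DI M Y W n l1 l2 = Sup {ereal (real N) | N. DI_code M Y W n N l1 l2}"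

definition DI_rate :: "'x measure \<Rightarrow> 'y set \<Rightarrow> ('x \<Rightarrow> 'y \<Rightarrow> real) \<Rightarrow> real \<Rightarrow> real \<Rightarrow> nat \<Rightarrow> ereal" where
  "DI_rate M Y W l1 l2 n =
     (if N_DI M Y W n l1 l2 = \<infinity> then \<infinity>
      else ereal (log 2 (real_of_ereal (N_DI M Y W n l1 l2)) / (real n * log 2 (real n))))"

definition C_DI :: "'x measure \<Rightarrow> 'y set \<Rightarrow> ('x \<Rightarrow> 'y \<Rightarrow> real) \<Rightarrow> ereal" where
  "C_DI M Y W = (INF l1\<in>{0<..}. INF l2\<in>{0<..}. liminf (DI_rate M Y W l1 l2))"

definition prod_channel :: "('x1 \<Rightarrow> 'y1 \<Rightarrow> real) \<Rightarrow> ('x2 \<Rightarrow> 'y2 \<Rightarrow> real) \<Rightarrow> ('x1 \<times> 'x2 \<Rightarrow> 'y1 \<times> 'y2 \<Rightarrow> real)" where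
  "prod_channel W1 W2 = (\<lambda>(x1, x2) (y1, y2). W1 x1 y1 * W2 x2 y2)"

end

theory Submission
  imports Defs "HOL-Real_Asymp.Real_Asymp"
begin

text \<open>Superadditivity: the product of two codes is a code for the product channel, with at most twice
  the first-kind error and the same second-kind error.

  Strictness: both channels send x to the binomial distribution with 2 trials and success
  probability x, and differ only in their sets of admissible x. Each set is a union of grids
  \<open>grid k\<close> in the intervals [0, 2 to the power - fact k], one set taking the even k and the other
  the odd k. Just below blocklength 2 to the power fact k, the set without \<open>grid (k - 1)\<close> is
  indistinguishable from a grid of much larger mesh and so admits few messages, whence both
  capacities vanish. But every large blocklength n is served by some \<open>grid k\<close>, which has
  polynomially many points at mutual distance well above n to the power -1/4. Words over these
  letters that differ in half of the positions are identified by a Chebyshev test, and a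
  Gilbert-Varshamov code supplies enough of them, with a rate of at least 1/64.\<close>

section \<open>Product distributions on words, and codes of large Hamming distance\<close>

lemma sum_PiE_insert:
  assumes "x \<notin> I"
  shows "(\<Sum>y\<in>PiE (insert x I) T. F y) = (\<Sum>a\<in>T x. \<Sum>g\<in>PiE I T. F (g(x := a)))"
  unfolding PiE_insert_eq sum.reindex[OF inj_combinator[OF assms]] sum.cartesian_product
  by (simp add: case_prod_unfold)

lemma prod_fun_upd_notin:
  assumes "x \<notin> I"
  shows "(\<Prod>i\<in>I. p i ((g(x := a)) i)) = (\<Prod>i\<in>I. p i (g i))"
  by (rule prod.cong) (use assms in auto)

lemma sum_fun_upd_notin:
  assumes "x \<notin> I"
  shows "(\<Sum>i\<in>I. h i ((g(x := a)) i)) = (\<Sum>i\<in>I. h i (g i))"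
  by (rule sum.cong) (use assms in auto)

lemma sum_prod_weights_eq_1:
  fixes p :: "'i \<Rightarrow> 'y \<Rightarrow> real"
  assumes "finite I" "finite Y" "\<And>i. i \<in> I \<Longrightarrow> sum (p i) Y = 1"
  shows "(\<Sum>y\<in>PiE I (\<lambda>_. Y). \<Prod>i\<in>I. p i (y i)) = 1"
  using assms by (simp flip: prod_sum_PiE)

text \<open>The factors are exchanged one at a time: p * P - q * Q = p * (P - Q) + (p - q) * Q.
  Summed over words, the first term reproduces the distance of the shorter products because p has
  mass 1, and the second adds the distance of the new coordinate because Q has mass 1.\<close>

lemma prod_weights_L1_dist:
  fixes p q :: "'i \<Rightarrow> 'y \<Rightarrow> real"
  assumes "finite I" "finite Y"
    and "\<And>i a. i \<in> I \<Longrightarrow> 0 \<le> p i a" "\<And>i. i \<in> I \<Longrightarrow> sum (p i) Y = 1"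
    and "\<And>i a. i \<in> I \<Longrightarrow> 0 \<le> q i a" "\<And>i. i \<in> I \<Longrightarrow> sum (q i) Y = 1"
  shows "(\<Sum>y\<in>PiE I (\<lambda>_. Y). \<bar>(\<Prod>i\<in>I. p i (y i)) - (\<Prod>i\<in>I. q i (y i))\<bar>)
           \<le> (\<Sum>i\<in>I. \<Sum>a\<in>Y. \<bar>p i a - q i a\<bar>)"
  using assms
proof (induction I rule: finite_induct)
  case empty
  then show ?case by simp
next
  case (insert x I)
  let ?P = "\<lambda>g. \<Prod>i\<in>I. p i (g i)" and ?Q = "\<lambda>g. \<Prod>i\<in>I. q i (g i)"
  let ?S = "PiE I (\<lambda>_. Y)"
  have Q0: "?Q g \<ge> 0" for g
    by (rule prod_nonneg) (use insert.prems in auto)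
  have Q1: "sum ?Q ?S = 1"
    by (rule sum_prod_weights_eq_1) (use insert in auto)
  have "(\<Sum>y\<in>PiE (insert x I) (\<lambda>_. Y). \<bar>(\<Prod>i\<in>insert x I. p i (y i)) - (\<Prod>i\<in>insert x I. q i (y i))\<bar>)
      = (\<Sum>a\<in>Y. \<Sum>g\<in>?S. \<bar>p x a * ?P g - q x a * ?Q g\<bar>)"
    using insert.hyps by (simp add: sum_PiE_insert prod_fun_upd_notin del: fun_upd_apply) simp
  also have "\<dots> \<le> (\<Sum>a\<in>Y. \<Sum>g\<in>?S. p x a * \<bar>?P g - ?Q g\<bar> + \<bar>p x a - q x a\<bar> * ?Q g)"
  proof (intro sum_mono)
    fix a g
    have "p x a * ?P g - q x a * ?Q g = p x a * (?P g - ?Q g) + (p x a - q x a) * ?Q g"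
      by (simp add: algebra_simps)
    also have "\<bar>\<dots>\<bar> \<le> \<bar>p x a * (?P g - ?Q g)\<bar> + \<bar>(p x a - q x a) * ?Q g\<bar>"
      by (rule abs_triangle_ineq)
    finally show "\<bar>p x a * ?P g - q x a * ?Q g\<bar> \<le> p x a * \<bar>?P g - ?Q g\<bar> + \<bar>p x a - q x a\<bar> * ?Q g"
      using Q0[of g] insert.prems(2)[of x a] by (simp add: abs_mult)
  qed
  also have "\<dots> = sum (p x) Y * (\<Sum>g\<in>?S. \<bar>?P g - ?Q g\<bar>) + (\<Sum>a\<in>Y. \<bar>p x a - q x a\<bar>) * sum ?Q ?S"
    by (simp add: sum.distrib sum_product)
  also have "\<dots> \<le> (\<Sum>i\<in>I. \<Sum>a\<in>Y. \<bar>p i a - q i a\<bar>) + (\<Sum>a\<in>Y. \<bar>p x a - q x a\<bar>)"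
    using insert.IH insert.prems Q1 by simp
  finally show ?case
    using insert.hyps by simp
qed

text \<open>Variances of independent coordinates add: when the square of the sum is expanded, the
  cross term contains the mean of \<open>h x\<close> as a factor, which is zero.\<close>

lemma prod_weights_second_moment:
  fixes p h :: "'i \<Rightarrow> 'y \<Rightarrow> real"
  assumes "finite I" "finite Y"
    and "\<And>i. i \<in> I \<Longrightarrow> sum (p i) Y = 1"
    and "\<And>i. i \<in> I \<Longrightarrow> (\<Sum>a\<in>Y. p i a * h i a) = 0"
  shows "(\<Sum>y\<in>PiE I (\<lambda>_. Y). (\<Prod>i\<in>I. p i (y i)) * (\<Sum>i\<in>I. h i (y i))\<^sup>2)
           = (\<Sum>i\<in>I. \<Sum>a\<in>Y. p i a * (h i a)\<^sup>2)"
  using assms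
proof (induction I rule: finite_induct)
  case empty
  then show ?case by simp
next
  case (insert x I)
  let ?P = "\<lambda>g. \<Prod>i\<in>I. p i (g i)" and ?H = "\<lambda>g. \<Sum>i\<in>I. h i (g i)"
  let ?S = "PiE I (\<lambda>_. Y)"
  have P1: "sum ?P ?S = 1"
    by (rule sum_prod_weights_eq_1) (use insert in auto)
  have "(\<Sum>y\<in>PiE (insert x I) (\<lambda>_. Y). (\<Prod>i\<in>insert x I. p i (y i)) * (\<Sum>i\<in>insert x I. h i (y i))\<^sup>2)
      = (\<Sum>a\<in>Y. \<Sum>g\<in>?S. p x a * ?P g * (h x a + ?H g)\<^sup>2)"
    using insert.hyps by (simp add: sum_PiE_insert prod_fun_upd_notin sum_fun_upd_notin del: fun_upd_apply) simp
  also have "\<dots> = (\<Sum>a\<in>Y. \<Sum>g\<in>?S. p x a * (h x a)\<^sup>2 * ?P g + p x a * h x a * (2 * ?P g * ?H g) + p x a * (?P g * (?H g)\<^sup>2))"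
    by (simp add: power2_eq_square algebra_simps)
  also have "\<dots> = (\<Sum>a\<in>Y. p x a * (h x a)\<^sup>2) * sum ?P ?S
       + (\<Sum>a\<in>Y. p x a * h x a) * (\<Sum>g\<in>?S. 2 * ?P g * ?H g)
       + sum (p x) Y * (\<Sum>g\<in>?S. ?P g * (?H g)\<^sup>2)"
    unfolding sum_product by (simp add: sum.distrib)
  also have "\<dots> = (\<Sum>a\<in>Y. p x a * (h x a)\<^sup>2) + (\<Sum>i\<in>I. \<Sum>a\<in>Y. p i a * (h i a)\<^sup>2)"
    using insert.IH insert.prems P1 by simp
  finally show ?case
    using insert.hyps by simp
qed

text \<open>A score bounded by 1 in absolute value has variance at most 1, so the total score has
  variance at most \<open>card I\<close>, and Chebyshev's inequality applies.\<close>

lemma prod_weights_Chebyshev: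
  fixes p g :: "'i \<Rightarrow> 'y \<Rightarrow> real"
  assumes fin: "finite I" "finite Y"
    and nn: "\<And>i a. i \<in> I \<Longrightarrow> 0 \<le> p i a" and s1: "\<And>i. i \<in> I \<Longrightarrow> sum (p i) Y = 1"
    and mean: "\<And>i. i \<in> I \<Longrightarrow> (\<Sum>a\<in>Y. p i a * g i a) = \<mu> i"
    and bd: "\<And>i a. i \<in> I \<Longrightarrow> a \<in> Y \<Longrightarrow> \<bar>g i a\<bar> \<le> 1"
    and E: "E \<subseteq> PiE I (\<lambda>_. Y)" and "\<tau> > 0"
    and dev: "\<And>y. y \<in> E \<Longrightarrow> \<tau> \<le> \<bar>(\<Sum>i\<in>I. g i (y i)) - (\<Sum>i\<in>I. \<mu> i)\<bar>"
  shows "(\<Sum>y\<in>E. \<Prod>i\<in>I. p i (y i)) \<le> card I / \<tau>\<^sup>2"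
proof -
  let ?P = "\<lambda>y. \<Prod>i\<in>I. p i (y i)" and ?S = "PiE I (\<lambda>_. Y)"
  define h where "h i a = g i a - \<mu> i" for i a
  have finS: "finite ?S" using fin by (intro finite_PiE) auto
  have P0: "?P y \<ge> 0" for y
    by (rule prod_nonneg) (use nn in auto)
  have "(\<Sum>y\<in>E. ?P y) * \<tau>\<^sup>2 = (\<Sum>y\<in>E. ?P y * \<tau>\<^sup>2)"
    by (simp add: sum_distrib_right)
  also have "\<dots> \<le> (\<Sum>y\<in>E. ?P y * (\<Sum>i\<in>I. h i (y i))\<^sup>2)"
  proof (intro sum_mono mult_left_mono P0)
    fix y assume "y \<in> E"
    with dev have "\<tau> \<le> \<bar>\<Sum>i\<in>I. h i (y i)\<bar>" by (simp add: h_def sum_subtractf)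
    then show "\<tau>\<^sup>2 \<le> (\<Sum>i\<in>I. h i (y i))\<^sup>2"
      using \<open>\<tau> > 0\<close> by (simp add: abs_le_square_iff[symmetric])
  qed
  also have "\<dots> \<le> (\<Sum>y\<in>?S. ?P y * (\<Sum>i\<in>I. h i (y i))\<^sup>2)"
    by (rule sum_mono2) (use finS E P0 in auto)
  also have "\<dots> = (\<Sum>i\<in>I. \<Sum>a\<in>Y. p i a * (h i a)\<^sup>2)"
    by (rule prod_weights_second_moment)
      (use fin s1 mean in \<open>auto simp: h_def algebra_simps sum_subtractf simp flip: sum_distrib_left\<close>)
  also have "\<dots> \<le> (\<Sum>i\<in>I. 1)"
  proof (rule sum_mono)
    fix i assume i: "i \<in> I"
    have "(\<Sum>a\<in>Y. p i a * (h i a)\<^sup>2) = (\<Sum>a\<in>Y. p i a * (g i a)\<^sup>2 - 2 * \<mu> i * (p i a * g i a) + (\<mu> i)\<^sup>2 * p i a)"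
      by (rule sum.cong) (auto simp: h_def power2_eq_square algebra_simps)
    also have "\<dots> = (\<Sum>a\<in>Y. p i a * (g i a)\<^sup>2) - 2 * \<mu> i * (\<Sum>a\<in>Y. p i a * g i a) + (\<mu> i)\<^sup>2 * sum (p i) Y"
      by (simp add: sum.distrib sum_subtractf sum_distrib_left)
    also have "\<dots> = (\<Sum>a\<in>Y. p i a * (g i a)\<^sup>2) - (\<mu> i)\<^sup>2"
      using mean[OF i] s1[OF i] by (simp add: power2_eq_square)
    also have "\<dots> \<le> (\<Sum>a\<in>Y. p i a * (g i a)\<^sup>2)" by simp
    also have "\<dots> \<le> (\<Sum>a\<in>Y. p i a * 1)"
      by (intro sum_mono mult_left_mono nn i) (use bd[OF i] in \<open>simp add: abs_square_le_1\<close>)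
    finally show "(\<Sum>a\<in>Y. p i a * (h i a)\<^sup>2) \<le> 1" using s1[OF i] by simp
  qed
  finally show ?thesis using \<open>\<tau> > 0\<close> by (simp add: field_simps)
qed

text \<open>The Hamming balls of radius d around the words of a maximal code cover everything.\<close>
lemma Gilbert_Varshamov:
  fixes Q :: "'a set"
  assumes "finite Q" "Q \<noteq> {}"
  obtains C where "C \<subseteq> PiE {..<n::nat} (\<lambda>_. Q)"
    "\<And>u v. u \<in> C \<Longrightarrow> v \<in> C \<Longrightarrow> u \<noteq> v \<Longrightarrow> d < card {i\<in>{..<n}. u i \<noteq> v i}"
    "card Q ^ n \<le> card C * (2 ^ n * card Q ^ d)"
proof -
  let ?S = "PiE {..<n} (\<lambda>_. Q)"
  let ?dist = "\<lambda>u v. card {i\<in>{..<n}. u i \<noteq> v i}"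
  let ?far = "\<lambda>C. \<forall>u\<in>C. \<forall>v\<in>C. u \<noteq> v \<longrightarrow> d < ?dist u v"
  have finS: "finite ?S" using assms by (intro finite_PiE) auto
  have "\<exists>C\<in>{C \<in> Pow ?S. ?far C}. \<forall>B\<in>{C \<in> Pow ?S. ?far C}. C \<subseteq> B \<longrightarrow> C = B"
    by (rule finite_has_maximal) (use finS in auto)
  then obtain C where CS: "C \<in> {C \<in> Pow ?S. ?far C}"
    and maxC: "\<forall>B\<in>{C \<in> Pow ?S. ?far C}. C \<subseteq> B \<longrightarrow> C = B" by (rule bexE)
  have C: "C \<subseteq> ?S" "?far C" using CS by simp_all
  have max: "C = B" if "B \<subseteq> ?S" "?far B" "C \<subseteq> B" for B
    using bspec[OF maxC, of B] that by simp
  have finC: "finite C" using C finS finite_subset by blast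
  have sym: "?dist u v = ?dist v u" for u v :: "nat \<Rightarrow> 'a"
    by (rule arg_cong[where f=card]) auto
  \<comment> \<open>A word at distance more than \<open>d\<close> from all of \<open>C\<close> could
    be added to \<open>C\<close>, against maximality.\<close>
  have cover: "\<exists>c\<in>C. ?dist w c \<le> d" if w: "w \<in> ?S" for w
  proof (rule ccontr)
    assume "\<not> ?thesis"
    then have far: "d < ?dist w c" if "c \<in> C" for c using that by auto
    have "?far (insert w C)"
    proof (intro ballI impI)
      fix u v assume "u \<in> insert w C" "v \<in> insert w C" "u \<noteq> v"
      then consider "u = w" "v \<in> C" | "u \<in> C" "v = w" | "u \<in> C" "v \<in> C" by blast
      then show "d < ?dist u v"
      proof cases
        case 2
        then show ?thesis using far[of u] sym[of u v] by simp
      qed (use far C(2) \<open>u \<noteq> v\<close> in blast)+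
    qed
    from max[OF _ this] w C(1) have "w \<in> C" by auto
    with far[of w] show False by simp
  qed
  let ?T = "{T \<in> Pow {..<n}. card T \<le> d}"
  \<comment> \<open>For \<open>c\<close> in \<open>C\<close>, \<open>?B c T\<close> consists of the
    words that agree with \<open>c\<close> off \<open>T\<close> and are arbitrary over
    \<open>Q\<close> on \<open>T\<close>. The ball around \<open>c\<close> is covered by these sets
    with \<open>card T\<close> at most \<open>d\<close>; there are at most 2^n choices of
    \<open>T\<close>, each contributing at most \<open>card Q ^ d\<close> words.\<close>
  let ?B = "\<lambda>c T. (\<lambda>g i. if i \<in> T then g i else c i) ` PiE T (\<lambda>_. Q)"
  have "?S \<subseteq> (\<Union>c\<in>C. \<Union>T\<in>?T. ?B c T)"
  proof
    fix w assume w: "w \<in> ?S"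
    from cover[OF w] obtain c where c: "c \<in> C" "?dist w c \<le> d" by auto
    let ?D = "{i\<in>{..<n}. w i \<noteq> c i}"
    \<comment> \<open>This must hold for every \<open>i\<close>, not only below \<open>n\<close>:
      beyond the blocklength both words take the default value \<open>undefined\<close>.\<close>
    have "w i = (if i \<in> ?D then restrict w ?D i else c i)" for i
      using w c(1) C(1) by (cases "i < n") (auto simp: PiE_def extensional_def)
    then have "w = (\<lambda>i. if i \<in> ?D then restrict w ?D i else c i)" by (rule ext)
    moreover have "restrict w ?D \<in> PiE ?D (\<lambda>_. Q)" using w by auto
    ultimately have "w \<in> ?B c ?D" by (rule image_eqI)
    moreover have "?D \<in> ?T" using c(2) by auto
    ultimately show "w \<in> (\<Union>c\<in>C. \<Union>T\<in>?T. ?B c T)" using c(1) by blast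
  qed
  moreover have finB: "finite (?B c T)" if "T \<in> ?T" for c T
    using that assms by (intro finite_imageI finite_PiE) (auto intro: finite_subset)
  ultimately have "card ?S \<le> card (\<Union>c\<in>C. \<Union>T\<in>?T. ?B c T)"
    using finC by (intro card_mono) auto
  also have "\<dots> \<le> (\<Sum>c\<in>C. card (\<Union>T\<in>?T. ?B c T))"
    by (rule card_UN_le[OF finC])
  also have "\<dots> \<le> (\<Sum>c\<in>C. 2 ^ n * card Q ^ d)"
  proof (rule sum_mono)
    fix c
    have "card (\<Union>T\<in>?T. ?B c T) \<le> (\<Sum>T\<in>?T. card (?B c T))"
      by (rule card_UN_le) simp
    also have "\<dots> \<le> (\<Sum>T\<in>?T. card Q ^ d)"
    proof (rule sum_mono)
      fix T assume T: "T \<in> ?T"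
      then have "finite T" by (auto intro: finite_subset)
      have "card (?B c T) \<le> card (PiE T (\<lambda>_. Q))"
        by (rule card_image_le) (use \<open>finite T\<close> assms in \<open>auto intro: finite_PiE\<close>)
      also have "\<dots> = card Q ^ card T" using \<open>finite T\<close> by (simp add: card_PiE)
      also have "\<dots> \<le> card Q ^ d"
        using T assms by (intro power_increasing) (auto simp: Suc_le_eq card_gt_0_iff)
      finally show "card (?B c T) \<le> card Q ^ d" .
    qed
    also have "\<dots> \<le> (\<Sum>T\<in>Pow {..<n}. card Q ^ d)"
      by (rule sum_mono2) auto
    finally show "card (\<Union>T\<in>?T. ?B c T) \<le> 2 ^ n * card Q ^ d"
      by (simp add: card_Pow)
  qed
  finally show ?thesis
    using C by (intro that[of C]) (auto simp: card_PiE)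
qed

section \<open>Identification codes, their maximal size and their rate\<close>

lemma channelD:
  assumes "channel M Y W"
  shows "finite Y" "space M \<noteq> {}" "x \<in> space M \<Longrightarrow> 0 \<le> W x y" "x \<in> space M \<Longrightarrow> sum (W x) Y = 1"
  using assms by (auto simp: channel_def)

lemma finite_out_words: "finite Y \<Longrightarrow> finite (out_words Y n)"
  by (simp add: out_words_def finite_PiE)

context
  fixes M :: "'x measure" and Y :: "'y set" and W :: "'x \<Rightarrow> 'y \<Rightarrow> real" and n :: nat and u :: "nat \<Rightarrow> 'x"
  assumes ch: "channel M Y W" and u: "\<And>i. i < n \<Longrightarrow> u i \<in> space M"
begin

lemma word_prob_out_words: "word_prob W n u (out_words Y n) = 1"
  unfolding word_prob_def out_words_def
  using sum_prod_weights_eq_1[of "{..<n}" Y "\<lambda>i. W (u i)"] channelD[OF ch] u by simp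

lemma word_prob_nonneg: "0 \<le> word_prob W n u E"
  unfolding word_prob_def
  by (intro sum_nonneg prod_nonneg) (use channelD(3)[OF ch] u in auto)

lemma word_prob_le_1:
  assumes "E \<subseteq> out_words Y n"
  shows "word_prob W n u E \<le> 1"
proof -
  have "word_prob W n u E \<le> word_prob W n u (out_words Y n)"
    unfolding word_prob_def
    by (intro sum_mono2 prod_nonneg)
      (use assms channelD(1,3)[OF ch] u in \<open>auto simp: finite_out_words\<close>)
  then show ?thesis by (simp add: word_prob_out_words)
qed

lemma word_prob_compl:
  assumes "E \<subseteq> out_words Y n"
  shows "word_prob W n u (out_words Y n - E) = 1 - word_prob W n u E"
  using word_prob_out_words finite_out_words[OF channelD(1)[OF ch]] assms
  by (simp add: word_prob_def sum_diff)

end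

lemma DI_codeE:
  assumes "DI_code M Y W n N l1 l2"
  obtains u E where "\<And>j i. j < N \<Longrightarrow> i < n \<Longrightarrow> u j i \<in> space M"
    "\<And>j. j < N \<Longrightarrow> E j \<subseteq> out_words Y n" "\<And>j. j < N \<Longrightarrow> 1 - l1 \<le> word_prob W n (u j) (E j)"
    "\<And>j k. j < N \<Longrightarrow> k < N \<Longrightarrow> j \<noteq> k \<Longrightarrow> word_prob W n (u j) (E k) \<le> l2"
proof -
  obtain u E where "\<forall>j<N. (\<forall>i<n. u j i \<in> space M) \<and> E j \<subseteq> out_words Y n \<and> 1 - l1 \<le> word_prob W n (u j) (E j)"
    and "\<forall>j<N. \<forall>k<N. j \<noteq> k \<longrightarrow> word_prob W n (u j) (E k) \<le> l2"
    using assms unfolding DI_code_def by (elim exE conjE)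
  then show ?thesis by (intro that[of u E]) simp_all
qed

lemma DI_code_0: "DI_code M Y W n 0 l1 l2"
  by (simp add: DI_code_def)

text \<open>With one message the second-kind condition is vacuous and every output may be accepted.
  This keeps the maximal size at least 1, hence all rates nonnegative.\<close>

lemma DI_code_1:
  assumes "channel M Y W" "0 \<le> l1"
  shows "DI_code M Y W n 1 l1 l2"
proof -
  obtain x where x: "x \<in> space M" using channelD(2)[OF assms(1)] by auto
  have "word_prob W n (\<lambda>_. x) (out_words Y n) = 1"
    by (rule word_prob_out_words[OF assms(1)]) (use x in auto)
  then show ?thesis unfolding DI_code_def
    by (intro exI[of _ "\<lambda>_ _. x"] exI[of _ "\<lambda>_. out_words Y n"]) (use x assms in auto)
qed

text \<open>The achievable sizes form a set of naturals that contains 0; if its extended-real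
  supremum is finite, the set is finite and the supremum is attained. Rates can then be handled
  through an actual largest code.\<close>

lemma N_DI_finite:
  assumes "N_DI M Y W n l1 l2 \<noteq> \<infinity>"
  obtains K where "DI_code M Y W n K l1 l2" "N_DI M Y W n l1 l2 = ereal (real K)"
    "\<And>N. DI_code M Y W n N l1 l2 \<Longrightarrow> N \<le> K"
proof -
  let ?S = "{N. DI_code M Y W n N l1 l2}"
  have le: "ereal (real N) \<le> N_DI M Y W n l1 l2" if "N \<in> ?S" for N
    unfolding N_DI_def by (rule Sup_upper) (use that in auto)
  have "0 \<in> ?S" by (simp add: DI_code_0)
  with le[of 0] have "N_DI M Y W n l1 l2 \<ge> 0" by (simp add: zero_ereal_def)
  with assms obtain r where r: "N_DI M Y W n l1 l2 = ereal r"
    by (cases "N_DI M Y W n l1 l2") auto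
  have "?S \<subseteq> {..nat \<lceil>r\<rceil>}"
  proof
    fix N assume "N \<in> ?S"
    with le[of N] have "real N \<le> r" by (simp add: r)
    then show "N \<in> {..nat \<lceil>r\<rceil>}" by simp linarith
  qed
  then have fin: "finite ?S" by (rule finite_subset) simp
  have "DI_code M Y W n (Max ?S) l1 l2" using Max_in[OF fin] \<open>0 \<in> ?S\<close> by blast
  moreover have max: "N \<le> Max ?S" if "DI_code M Y W n N l1 l2" for N
    using that fin by simp
  moreover have "N_DI M Y W n l1 l2 = ereal (real (Max ?S))"
  proof (rule antisym)
    show "N_DI M Y W n l1 l2 \<le> ereal (real (Max ?S))"
      unfolding N_DI_def by (rule Sup_least) (use max in auto)
  qed (use le calculation(1) in simp)
  ultimately show ?thesis using that by blast
qed

lemma denominator_nonneg: "0 \<le> real n * log 2 (real n)"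
  by (cases "n = 0") auto

lemma DI_rate_ge:
  assumes "DI_code M Y W n N l1 l2" "1 \<le> N"
  shows "ereal (log 2 (real N) / (real n * log 2 (real n))) \<le> DI_rate M Y W l1 l2 n"
proof (cases "N_DI M Y W n l1 l2 = \<infinity>")
  case False
  then obtain K where K: "N_DI M Y W n l1 l2 = ereal (real K)" "N \<le> K"
    using assms by (metis N_DI_finite)
  then have "log 2 (real N) \<le> log 2 (real K)" using assms by simp
  then show ?thesis using K(1) denominator_nonneg
    by (simp add: DI_rate_def divide_right_mono)
qed (simp add: DI_rate_def)

lemma DI_rate_le:
  assumes "\<And>N. DI_code M Y W n N l1 l2 \<Longrightarrow> real N \<le> B" "1 \<le> B"
  shows "DI_rate M Y W l1 l2 n \<le> ereal (log 2 B / (real n * log 2 (real n)))"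
proof -
  have "N_DI M Y W n l1 l2 \<le> ereal B"
    unfolding N_DI_def by (rule Sup_least) (use assms in auto)
  then have "N_DI M Y W n l1 l2 \<noteq> \<infinity>" by auto
  then obtain K where K: "DI_code M Y W n K l1 l2" "N_DI M Y W n l1 l2 = ereal (real K)"
    by (metis N_DI_finite)
  \<comment> \<open>For \<open>K = 0\<close> the logarithm takes its default value 0, which
    \<open>1 \<le> B\<close> covers.\<close>
  have "log 2 (real K) \<le> log 2 B"
    using assms(1)[OF K(1)] assms(2) by (cases "K = 0") (auto simp: log_def divide_right_mono)
  then show ?thesis using K(2) denominator_nonneg
    by (simp add: DI_rate_def divide_right_mono)
qed

lemma DI_rate_nonneg:
  assumes "channel M Y W" "0 \<le> l1"
  shows "0 \<le> DI_rate M Y W l1 l2 n"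
  using DI_rate_ge[OF DI_code_1[OF assms]] by (simp add: zero_ereal_def)

lemma C_DI_nonneg:
  assumes "channel M Y W"
  shows "0 \<le> C_DI M Y W"
  unfolding C_DI_def
  by (intro INF_greatest Liminf_bounded always_eventually allI DI_rate_nonneg assms) auto

section \<open>Product codes and superadditivity\<close>

text \<open>Identifies pairs of output words with words of output pairs. The restriction to
  \<open>{..<n}\<close> makes the result extensional, as membership in \<open>out_words\<close>
  demands.\<close>

definition zip_words :: "nat \<Rightarrow> (nat \<Rightarrow> 'a) \<times> (nat \<Rightarrow> 'b) \<Rightarrow> nat \<Rightarrow> 'a \<times> 'b" where
  "zip_words n = (\<lambda>(a, b). \<lambda>i\<in>{..<n}. (a i, b i))"

lemma inj_on_zip_words: "inj_on (zip_words n) (out_words Y1 n \<times> out_words Y2 n)"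
proof (rule inj_onI, clarify)
  fix a b a' b' assume mem: "a \<in> out_words Y1 n" "a' \<in> out_words Y1 n" "b \<in> out_words Y2 n" "b' \<in> out_words Y2 n"
    and eq: "zip_words n (a, b) = zip_words n (a', b')"
  have "a i = a' i \<and> b i = b' i" if "i < n" for i
    using fun_cong[OF eq, of i] that by (simp add: zip_words_def)
  with mem show "a = a' \<and> b = b'"
    unfolding out_words_def by (meson PiE_ext lessThan_iff)
qed

lemma word_prob_prod_channel:
  assumes "E \<subseteq> out_words Y1 n" "F \<subseteq> out_words Y2 n"
  shows "word_prob (prod_channel W1 W2) n (\<lambda>i. (u i, v i)) (zip_words n ` (E \<times> F))
           = word_prob W1 n u E * word_prob W2 n v F"
proof -
  have "inj_on (zip_words n) (E \<times> F)"
    by (rule inj_on_subset[OF inj_on_zip_words]) (use assms in auto)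
  then have "word_prob (prod_channel W1 W2) n (\<lambda>i. (u i, v i)) (zip_words n ` (E \<times> F))
      = (\<Sum>(a, b)\<in>E \<times> F. (\<Prod>i<n. W1 (u i) (a i)) * (\<Prod>i<n. W2 (v i) (b i)))"
    unfolding word_prob_def
    by (subst sum.reindex) (auto intro!: sum.cong simp: zip_words_def prod_channel_def prod.distrib)
  also have "\<dots> = word_prob W1 n u E * word_prob W2 n v F"
    by (simp add: word_prob_def sum_product sum.cartesian_product)
  finally show ?thesis .
qed

text \<open>Messages are pairs, numbered by quotient and remainder modulo \<open>N2\<close>.
  Acceptance probabilities multiply: the first-kind bound follows from a * b \<ge> a + b - 1 for a,
  b \<le> 1. Distinct messages differ in some component, whose factor is at most \<open>l2\<close>,
  while the other factor is at most 1.\<close>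

lemma DI_code_prod:
  assumes ch1: "channel M1 Y1 W1" and ch2: "channel M2 Y2 W2"
    and "DI_code M1 Y1 W1 n N1 l1 l2" "DI_code M2 Y2 W2 n N2 l1 l2"
  shows "DI_code (M1 \<Otimes>\<^sub>M M2) (Y1 \<times> Y2) (prod_channel W1 W2) n (N1 * N2) (2 * l1) l2"
proof -
  obtain u E where
    u: "\<And>j i. j < N1 \<Longrightarrow> i < n \<Longrightarrow> u j i \<in> space M1" and
    E: "\<And>j. j < N1 \<Longrightarrow> E j \<subseteq> out_words Y1 n" "\<And>j. j < N1 \<Longrightarrow> 1 - l1 \<le> word_prob W1 n (u j) (E j)"
      "\<And>j k. j < N1 \<Longrightarrow> k < N1 \<Longrightarrow> j \<noteq> k \<Longrightarrow> word_prob W1 n (u j) (E k) \<le> l2"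
    by (rule DI_codeE[OF assms(3)]) (rule that)
  obtain v F where
    v: "\<And>j i. j < N2 \<Longrightarrow> i < n \<Longrightarrow> v j i \<in> space M2" and
    F: "\<And>j. j < N2 \<Longrightarrow> F j \<subseteq> out_words Y2 n" "\<And>j. j < N2 \<Longrightarrow> 1 - l1 \<le> word_prob W2 n (v j) (F j)"
      "\<And>j k. j < N2 \<Longrightarrow> k < N2 \<Longrightarrow> j \<noteq> k \<Longrightarrow> word_prob W2 n (v j) (F k) \<le> l2"
    by (rule DI_codeE[OF assms(4)]) (rule that)
  let ?u = "\<lambda>j i. (u (j div N2) i, v (j mod N2) i)"
  let ?E = "\<lambda>j. zip_words n ` (E (j div N2) \<times> F (j mod N2))"
  have idx: "j div N2 < N1" "j mod N2 < N2" if "j < N1 * N2" for j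
  proof -
    have "N2 > 0" using that by (cases N2) auto
    then show "j div N2 < N1" "j mod N2 < N2"
      using that by (auto simp: less_mult_imp_div_less)
  qed
  have wp: "word_prob (prod_channel W1 W2) n (?u j) (?E k)
      = word_prob W1 n (u (j div N2)) (E (k div N2)) * word_prob W2 n (v (j mod N2)) (F (k mod N2))"
    if "k < N1 * N2" for j k
    by (rule word_prob_prod_channel) (use E(1) F(1) idx[OF that] in auto)
  have b1: "0 \<le> word_prob W1 n (u j) (E k)" "word_prob W1 n (u j) (E k) \<le> 1" if "j < N1" "k < N1" for j k
    using word_prob_nonneg[OF ch1] word_prob_le_1[OF ch1] u E(1) that by auto
  have b2: "0 \<le> word_prob W2 n (v j) (F k)" "word_prob W2 n (v j) (F k) \<le> 1" if "j < N2" "k < N2" for j k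
    using word_prob_nonneg[OF ch2] word_prob_le_1[OF ch2] v F(1) that by auto
  show ?thesis
    unfolding DI_code_def
  proof (rule exI[of _ ?u], rule exI[of _ ?E], intro conjI allI impI)
    fix j i assume "j < N1 * N2" "i < n"
    then show "?u j i \<in> space (M1 \<Otimes>\<^sub>M M2)"
      using u v idx by (simp add: space_pair_measure)
  next
    fix j assume j: "j < N1 * N2"
    show "?E j \<subseteq> out_words (Y1 \<times> Y2) n"
      using E(1) F(1) idx[OF j] by (fastforce simp: zip_words_def out_words_def)
    let ?a = "word_prob W1 n (u (j div N2)) (E (j div N2))"
    let ?b = "word_prob W2 n (v (j mod N2)) (F (j mod N2))"
    have "0 \<le> (1 - ?a) * (1 - ?b)"
      using b1(2) b2(2) idx[OF j] by simp
    then have "?a + ?b - 1 \<le> ?a * ?b" by (simp add: algebra_simps)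
    moreover have "1 - l1 \<le> ?a" "1 - l1 \<le> ?b" using E(2) F(2) idx[OF j] by auto
    ultimately show "1 - 2 * l1 \<le> word_prob (prod_channel W1 W2) n (?u j) (?E j)"
      using wp[OF j] by simp
  next
    fix j k assume j: "j < N1 * N2" and k: "k < N1 * N2" and "j \<noteq> k"
    let ?a = "word_prob W1 n (u (j div N2)) (E (k div N2))"
    let ?b = "word_prob W2 n (v (j mod N2)) (F (k mod N2))"
    have a: "0 \<le> ?a" "?a \<le> 1" and b: "0 \<le> ?b" "?b \<le> 1"
      using b1 b2 idx[OF j] idx[OF k] by auto
    from \<open>j \<noteq> k\<close> have "j div N2 \<noteq> k div N2 \<or> j mod N2 \<noteq> k mod N2"
      by (metis div_mult_mod_eq)
    then have "?a \<le> l2 \<or> ?b \<le> l2"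
      using E(3) F(3) idx[OF j] idx[OF k] by blast
    then have "?a * ?b \<le> l2"
      using mult_left_le[OF b(2) a(1)] mult_left_le[OF a(2) b(1)] by (auto simp: mult.commute)
    then show "word_prob (prod_channel W1 W2) n (?u j) (?E k) \<le> l2"
      using wp[OF k] by simp
  qed
qed

lemma DI_rate_prod:
  assumes ch1: "channel M1 Y1 W1" and ch2: "channel M2 Y2 W2" and "0 \<le> l1"
  shows "DI_rate M1 Y1 W1 l1 l2 n + DI_rate M2 Y2 W2 l1 l2 n
           \<le> DI_rate (M1 \<Otimes>\<^sub>M M2) (Y1 \<times> Y2) (prod_channel W1 W2) (2 * l1) l2 n"
proof (cases "N_DI (M1 \<Otimes>\<^sub>M M2) (Y1 \<times> Y2) (prod_channel W1 W2) n (2 * l1) l2 = \<infinity>")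
  case True
  then show ?thesis by (simp add: DI_rate_def)
next
  case False
  then obtain K where K: "\<And>N. DI_code (M1 \<Otimes>\<^sub>M M2) (Y1 \<times> Y2) (prod_channel W1 W2) n N (2 * l1) l2 \<Longrightarrow> N \<le> K"
    by (metis N_DI_finite)
  \<comment> \<open>Pairing with a one-message code turns a code for either factor into a product
    code of the same size, so finiteness for the product forces finiteness for both factors.\<close>
  have le1: "N \<le> K" if "DI_code M1 Y1 W1 n N l1 l2" for N
    using K[OF DI_code_prod[OF ch1 ch2 that DI_code_1[OF ch2 \<open>0 \<le> l1\<close>]]] by simp
  have le2: "N \<le> K" if "DI_code M2 Y2 W2 n N l1 l2" for N
    using K[OF DI_code_prod[OF ch1 ch2 DI_code_1[OF ch1 \<open>0 \<le> l1\<close>] that]] by simp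
  have "N_DI M1 Y1 W1 n l1 l2 \<le> ereal K" "N_DI M2 Y2 W2 n l1 l2 \<le> ereal K"
    unfolding N_DI_def by (rule Sup_least, use le1 le2 in auto)+
  then have fin: "N_DI M1 Y1 W1 n l1 l2 \<noteq> \<infinity>" "N_DI M2 Y2 W2 n l1 l2 \<noteq> \<infinity>" by auto
  obtain N1 where N1: "DI_code M1 Y1 W1 n N1 l1 l2" "N_DI M1 Y1 W1 n l1 l2 = ereal (real N1)" "1 \<le> N1"
    using N_DI_finite[OF fin(1)] DI_code_1[OF ch1 \<open>0 \<le> l1\<close>] by metis
  obtain N2 where N2: "DI_code M2 Y2 W2 n N2 l1 l2" "N_DI M2 Y2 W2 n l1 l2 = ereal (real N2)" "1 \<le> N2"
    using N_DI_finite[OF fin(2)] DI_code_1[OF ch2 \<open>0 \<le> l1\<close>] by metis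
  have "DI_rate M1 Y1 W1 l1 l2 n + DI_rate M2 Y2 W2 l1 l2 n
      = ereal (log 2 (real (N1 * N2)) / (real n * log 2 (real n)))"
    using N1 N2 by (simp add: DI_rate_def log_mult add_divide_distrib)
  also have "\<dots> \<le> DI_rate (M1 \<Otimes>\<^sub>M M2) (Y1 \<times> Y2) (prod_channel W1 W2) (2 * l1) l2 n"
    by (rule DI_rate_ge[OF DI_code_prod[OF ch1 ch2 N1(1) N2(1)]]) (use N1(3) N2(3) in simp)
  finally show ?thesis .
qed

text \<open>The doubled first-kind error costs nothing: \<open>C_DI\<close> is an infimum over all
  positive errors, so the factors may be used with error \<open>l1/2\<close>.\<close>

lemma C_DI_superadditive:
  assumes ch1: "channel M1 Y1 W1" and ch2: "channel M2 Y2 W2"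
  shows "C_DI M1 Y1 W1 + C_DI M2 Y2 W2 \<le> C_DI (M1 \<Otimes>\<^sub>M M2) (Y1 \<times> Y2) (prod_channel W1 W2)"
  unfolding C_DI_def[of "M1 \<Otimes>\<^sub>M M2"]
proof (intro INF_greatest)
  fix l1 l2 :: real assume l: "l1 \<in> {0<..}" "l2 \<in> {0<..}"
  let ?r1 = "DI_rate M1 Y1 W1 (l1/2) l2" and ?r2 = "DI_rate M2 Y2 W2 (l1/2) l2"
  \<comment> \<open>Nonnegativity excludes the indeterminate sum of opposite infinities when the two
    limits inferior are added.\<close>
  have "0 \<le> liminf ?r1" "0 \<le> liminf ?r2"
    using l by (auto intro!: Liminf_bounded always_eventually DI_rate_nonneg ch1 ch2)
  then have "liminf ?r1 + liminf ?r2 \<le> liminf (\<lambda>n. ?r1 n + ?r2 n)"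
    by (intro ereal_liminf_add_mono) auto
  also have "\<dots> \<le> liminf (DI_rate (M1 \<Otimes>\<^sub>M M2) (Y1 \<times> Y2) (prod_channel W1 W2) l1 l2)"
    using DI_rate_prod[OF ch1 ch2, of "l1/2" l2] l by (intro Liminf_mono always_eventually) auto
  finally have "liminf ?r1 + liminf ?r2 \<le> \<dots>" .
  moreover have "C_DI M1 Y1 W1 \<le> liminf ?r1" "C_DI M2 Y2 W2 \<le> liminf ?r2"
    unfolding C_DI_def by (rule INF_lower2[of "l1/2"], use l in simp, rule INF_lower2[of l2], use l in auto)+
  ultimately show "C_DI M1 Y1 W1 + C_DI M2 Y2 W2
      \<le> liminf (DI_rate (M1 \<Otimes>\<^sub>M M2) (Y1 \<times> Y2) (prod_channel W1 W2) l1 l2)"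
    by (meson add_mono order_trans)
qed

section \<open>Upper bounds on code size from indistinguishable letters\<close>

lemma word_prob_diff_le:
  assumes ch: "channel M Y W" and u: "\<And>i. i < n \<Longrightarrow> u i \<in> space M" and v: "\<And>i. i < n \<Longrightarrow> v i \<in> space M"
    and E: "E \<subseteq> out_words Y n"
  shows "\<bar>word_prob W n u E - word_prob W n v E\<bar> \<le> (\<Sum>i<n. \<Sum>a\<in>Y. \<bar>W (u i) a - W (v i) a\<bar>)"
proof -
  let ?d = "\<lambda>y. \<bar>(\<Prod>i<n. W (u i) (y i)) - (\<Prod>i<n. W (v i) (y i))\<bar>"
  have "\<bar>word_prob W n u E - word_prob W n v E\<bar> \<le> sum ?d E"
    unfolding word_prob_def sum_subtractf[symmetric] by (rule sum_abs)
  also have "\<dots> \<le> sum ?d (out_words Y n)"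
    by (rule sum_mono2) (use E finite_out_words[OF channelD(1)[OF ch]] in auto)
  also have "\<dots> \<le> (\<Sum>i<n. \<Sum>a\<in>Y. \<bar>W (u i) a - W (v i) a\<bar>)"
    unfolding out_words_def
    by (rule prod_weights_L1_dist) (use channelD[OF ch] u v in auto)
  finally show ?thesis .
qed

text \<open>Code words with the same sequence of classes \<open>\<phi>\<close> cannot both be identified.\<close>
lemma DI_code_size_le:
  fixes \<phi> :: "'x \<Rightarrow> 'c" and \<delta> :: real
  assumes ch: "channel M Y W" and code: "DI_code M Y W n N l1 l2"
    and R: "finite R" "\<phi> ` space M \<subseteq> R"
    and close: "\<And>x x'. x \<in> space M \<Longrightarrow> x' \<in> space M \<Longrightarrow> \<phi> x = \<phi> x' \<Longrightarrow> (\<Sum>a\<in>Y. \<bar>W x a - W x' a\<bar>) \<le> \<delta>"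
    and small: "l1 + l2 + n * \<delta> < 1"
  shows "N \<le> card R ^ n"
proof -
  obtain u E where u: "\<And>j i. j < N \<Longrightarrow> i < n \<Longrightarrow> u j i \<in> space M"
    and E: "\<And>j. j < N \<Longrightarrow> E j \<subseteq> out_words Y n" "\<And>j. j < N \<Longrightarrow> 1 - l1 \<le> word_prob W n (u j) (E j)"
      "\<And>j k. j < N \<Longrightarrow> k < N \<Longrightarrow> j \<noteq> k \<Longrightarrow> word_prob W n (u j) (E k) \<le> l2"
    by (rule DI_codeE[OF code]) (rule that)
  let ?c = "\<lambda>j. \<lambda>i\<in>{..<n}. \<phi> (u j i)"
  \<comment> \<open>Two messages with the same class word would give \<open>E j\<close>
    probabilities differing by at most \<open>n * \<delta>\<close>, whereas the code requires a gap
    of at least \<open>1 - l1 - l2\<close>.\<close>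
  have "inj_on ?c {..<N}"
  proof (rule inj_onI, rule ccontr)
    fix j k assume jk: "j \<in> {..<N}" "k \<in> {..<N}" "?c j = ?c k" "j \<noteq> k"
    have "\<phi> (u j i) = \<phi> (u k i)" if "i < n" for i
      using fun_cong[OF jk(3), of i] that by simp
    then have "(\<Sum>i<n. \<Sum>a\<in>Y. \<bar>W (u j i) a - W (u k i) a\<bar>) \<le> (\<Sum>i<n. \<delta>)"
      by (intro sum_mono close) (use u jk in auto)
    moreover have "\<bar>word_prob W n (u j) (E j) - word_prob W n (u k) (E j)\<bar>
        \<le> (\<Sum>i<n. \<Sum>a\<in>Y. \<bar>W (u j i) a - W (u k i) a\<bar>)"
      by (rule word_prob_diff_le[OF ch]) (use u E(1) jk in auto)
    moreover have "1 - l1 \<le> word_prob W n (u j) (E j)" "word_prob W n (u k) (E j) \<le> l2"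
      using E(2)[of j] E(3)[of k j] jk by auto
    ultimately show False using small by simp
  qed
  moreover have "?c ` {..<N} \<subseteq> PiE {..<n} (\<lambda>_. R)"
    using u R(2) by (auto simp: image_subset_iff)
  ultimately have "card {..<N} \<le> card (PiE {..<n} (\<lambda>_. R))"
    by (rule card_inj_on_le) (use R(1) in \<open>auto intro: finite_PiE\<close>)
  then show ?thesis by (simp add: card_PiE)
qed

section \<open>The binomial channel and an identification test for it\<close>

text \<open>Two trials are taken because every function of a single Bernoulli(v) bit has a mean
  affine in v, so one bit admits no unbiased estimate of (u - v)^2.\<close>

definition bin2 :: "real \<Rightarrow> nat \<Rightarrow> real" where
  "bin2 x y = (if y = 0 then (1 - x)\<^sup>2 else if y = 1 then 2 * x * (1 - x) else if y = 2 then x\<^sup>2 else 0)"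

lemma bin2_nonneg: "x \<in> {0..1} \<Longrightarrow> 0 \<le> bin2 x y"
  by (simp add: bin2_def)

lemma sum_bin2: "sum (bin2 x) {0, 1, 2} = 1"
  by (simp add: bin2_def power2_eq_square algebra_simps)

lemma channel_bin2:
  assumes "A \<subseteq> {0..1}" "A \<noteq> {}"
  shows "channel (count_space A) {0, 1, 2} bin2"
  unfolding channel_def using assms bin2_nonneg sum_bin2
  by (auto simp: subset_iff) (simp_all add: bin2_def)

text \<open>For each of the three outputs the difference is x - x' times a factor of absolute value
  at most 2.\<close>

lemma bin2_L1_dist:
  assumes "x \<in> {0..1}" "x' \<in> {0..1}"
  shows "(\<Sum>a\<in>{0, 1, 2}. \<bar>bin2 x a - bin2 x' a\<bar>) \<le> 6 * \<bar>x - x'\<bar>"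
proof -
  have *: "\<bar>c * (x - x')\<bar> \<le> 2 * \<bar>x - x'\<bar>" if "\<bar>c\<bar> \<le> 2" for c
    using mult_right_mono[OF that, of "\<bar>x - x'\<bar>"] by (simp add: abs_mult)
  have "(1 - x)\<^sup>2 - (1 - x')\<^sup>2 = (x + x' - 2) * (x - x')"
    "2 * x * (1 - x) - 2 * x' * (1 - x') = 2 * (1 - x - x') * (x - x')"
    "x\<^sup>2 - x'\<^sup>2 = (x + x') * (x - x')"
    by (simp_all add: power2_eq_square algebra_simps)
  then have "\<bar>bin2 x 0 - bin2 x' 0\<bar> \<le> 2 * \<bar>x - x'\<bar>" "\<bar>bin2 x 1 - bin2 x' 1\<bar> \<le> 2 * \<bar>x - x'\<bar>"
    "\<bar>bin2 x 2 - bin2 x' 2\<bar> \<le> 2 * \<bar>x - x'\<bar>"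
    using *[of "x + x' - 2"] *[of "2 * (1 - x - x')"] *[of "x + x'"] assms by (simp_all add: bin2_def abs_le_iff)
  then show ?thesis by simp
qed

text \<open>Two independent Bernoulli(v) bits b, b' with y = b + b': the score is the conditional mean
  of (b - u) * (b' - u) given y, hence an unbiased estimate of the squared distance.\<close>
definition score :: "real \<Rightarrow> nat \<Rightarrow> real" where
  "score u y = (if y = 0 then u\<^sup>2 else if y = 1 then - u * (1 - u) else (1 - u)\<^sup>2)"

lemma mean_score: "(\<Sum>a\<in>{0, 1, 2}. bin2 v a * score u a) = (u - v)\<^sup>2"
  by (simp add: bin2_def score_def power2_eq_square algebra_simps)

lemma abs_score_le_1:
  assumes "u \<in> {0..1}"
  shows "\<bar>score u y\<bar> \<le> 1"
proof -
  have u: "\<bar>u\<bar> \<le> 1" "\<bar>1 - u\<bar> \<le> 1" using assms by auto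
  then have "\<bar>u\<bar> * \<bar>1 - u\<bar> \<le> 1 * 1" by (intro mult_mono) auto
  with u show ?thesis
    by (simp add: score_def abs_square_le_1 abs_mult)
qed

text \<open>The test for \<open>u\<close> accepts when the total score is below
  \<open>\<tau>\<close> = n s^2 / 4. Under \<open>u\<close> itself the mean score is 0; under
  another code word, which differs from \<open>u\<close> in at least half of the positions, it is at
  least n s^2 / 2 = 2 \<open>\<tau>\<close>. Either error therefore needs a deviation of at least
  \<open>\<tau>\<close>, and Chebyshev bounds it by n / \<open>\<tau>\<close>^2 = 16 / (n
  s^4).\<close>

lemma DI_code_bin2:
  fixes s l1 l2 :: real and n :: nat
  assumes A: "A \<subseteq> {0..1}" and Q: "finite Q" "Q \<noteq> {}" "Q \<subseteq> A"
    and sep: "\<And>a b. a \<in> Q \<Longrightarrow> b \<in> Q \<Longrightarrow> a \<noteq> b \<Longrightarrow> s \<le> \<bar>a - b\<bar>" and "0 < s" "0 < n"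
    and l: "16 / (n * s ^ 4) \<le> l1" "16 / (n * s ^ 4) \<le> l2"
  obtains N where "DI_code (count_space A) {0, 1, 2} bin2 n N l1 l2"
    "card Q ^ n \<le> N * (2 ^ n * card Q ^ (n div 2))"
proof -
  let ?Y = "{0, 1, 2} :: nat set"
  obtain C where C: "C \<subseteq> PiE {..<n} (\<lambda>_. Q)"
    and dist: "\<And>u v. u \<in> C \<Longrightarrow> v \<in> C \<Longrightarrow> u \<noteq> v \<Longrightarrow> n div 2 < card {i\<in>{..<n}. u i \<noteq> v i}"
    and card: "card Q ^ n \<le> card C * (2 ^ n * card Q ^ (n div 2))"
    by (rule Gilbert_Varshamov[OF Q(1,2), of n "n div 2"]) (rule that)
  have "finite C" by (rule finite_subset[OF C]) (use Q in \<open>auto intro: finite_PiE\<close>)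
  then obtain h where h: "bij_betw h {0..<card C} C" using ex_bij_betw_nat_finite by blast
  define \<tau> where "\<tau> = n / 4 * s\<^sup>2"
  have "\<tau> > 0" using assms by (simp add: \<tau>_def)
  have \<tau>2: "n / \<tau>\<^sup>2 = 16 / (n * s ^ 4)"
    using \<open>0 < s\<close> \<open>0 < n\<close> by (simp add: \<tau>_def field_simps power2_eq_square power4_eq_xxxx)
  have mem: "u i \<in> {0..1}" "u i \<in> A" if "u \<in> C" "i < n" for u i
    using that C Q A by (auto simp: PiE_def Pi_def subset_iff)
  define S where "S u y = (\<Sum>i<n. score (u i) (y i))" for u :: "nat \<Rightarrow> real" and y
  define E where "E u = {y \<in> out_words ?Y n. S u y < \<tau>}" for u
  have dev: "word_prob bin2 n v F \<le> 16 / (n * s ^ 4)"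
    if "u \<in> C" "v \<in> C" "F \<subseteq> out_words ?Y n"
      "\<And>y. y \<in> F \<Longrightarrow> \<tau> \<le> \<bar>S u y - (\<Sum>i<n. (u i - v i)\<^sup>2)\<bar>" for u v F
  proof -
    have "word_prob bin2 n v F \<le> card {..<n} / \<tau>\<^sup>2"
      unfolding word_prob_def
      by (rule prod_weights_Chebyshev[where Y="?Y" and g="\<lambda>i. score (u i)" and \<mu>="\<lambda>i. (u i - v i)\<^sup>2"])
        (use that mem \<open>\<tau> > 0\<close> in \<open>auto simp: bin2_nonneg sum_bin2 mean_score abs_score_le_1 S_def
            out_words_def simp del: sum.insert One_nat_def\<close>)
    with \<tau>2 show ?thesis by simp
  qed
  have ch: "channel (count_space A) ?Y bin2" using A Q by (intro channel_bin2) auto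
  have miss: "1 - l1 \<le> word_prob bin2 n u (E u)" if "u \<in> C" for u
  proof -
    have "word_prob bin2 n u (out_words ?Y n - E u) \<le> 16 / (n * s ^ 4)"
      by (rule dev[of u u]) (use that in \<open>auto simp: E_def\<close>)
    moreover have "word_prob bin2 n u (out_words ?Y n - E u) = 1 - word_prob bin2 n u (E u)"
      by (rule word_prob_compl[OF ch]) (use that mem in \<open>auto simp: E_def\<close>)
    ultimately show ?thesis using l by simp
  qed
  have false_id: "word_prob bin2 n v (E u) \<le> l2" if "u \<in> C" "v \<in> C" "u \<noteq> v" for u v
  proof -
    let ?D = "{i\<in>{..<n}. u i \<noteq> v i}"
    have "2 * \<tau> \<le> real (card ?D) * s\<^sup>2"
    proof -
      have "n \<le> 2 * card ?D" using dist[OF that] by simp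
      then have "real n / 2 \<le> real (card ?D)" by simp
      from mult_right_mono[OF this, of "s\<^sup>2"] show ?thesis by (simp add: \<tau>_def)
    qed
    also have "\<dots> = (\<Sum>i\<in>?D. s\<^sup>2)" by simp
    also have "\<dots> \<le> (\<Sum>i\<in>?D. (u i - v i)\<^sup>2)"
    proof (rule sum_mono)
      fix i assume i: "i \<in> ?D"
      then have "u i \<in> Q" "v i \<in> Q" using C that by (auto simp: PiE_def Pi_def subset_iff)
      with sep i have "s \<le> \<bar>u i - v i\<bar>" by auto
      then show "s\<^sup>2 \<le> (u i - v i)\<^sup>2" using \<open>0 < s\<close> by (simp add: abs_le_square_iff[symmetric])
    qed
    also have "\<dots> \<le> (\<Sum>i<n. (u i - v i)\<^sup>2)" by (rule sum_mono2) auto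
    finally have "2 * \<tau> \<le> (\<Sum>i<n. (u i - v i)\<^sup>2)" .
    then have "word_prob bin2 n v (E u) \<le> 16 / (n * s ^ 4)"
      by (intro dev[of u v]) (use that in \<open>auto simp: E_def\<close>)
    then show ?thesis using l by simp
  qed
  have hC: "h j \<in> C" if "j < card C" for j using bij_betwE[OF h] that by simp
  have hne: "h j \<noteq> h k" if "j < card C" "k < card C" "j \<noteq> k" for j k
    using bij_betw_imp_inj_on[OF h] that by (auto simp: inj_on_eq_iff)
  have "DI_code (count_space A) ?Y bin2 n (card C) l1 l2"
    unfolding DI_code_def
  proof (rule exI[of _ h], rule exI[of _ "\<lambda>j. E (h j)"], intro conjI allI impI)
    fix j i assume "j < card C" "i < n"
    then show "h j i \<in> space (count_space A)" using hC mem by simp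
  next
    fix j assume "j < card C"
    then show "E (h j) \<subseteq> out_words ?Y n" "1 - l1 \<le> word_prob bin2 n (h j) (E (h j))"
      using hC miss by (auto simp: E_def)
  next
    fix j k assume "j < card C" "k < card C" "j \<noteq> k"
    then show "word_prob bin2 n (h j) (E (h k)) \<le> l2"
      using hC hne[of j k] false_id[of "h k" "h j"] by metis
  qed
  then show ?thesis using that card by blast
qed

section \<open>Sparse input sets and their vanishing capacities\<close>

text \<open>Grid \<open>k\<close> is meant for blocklengths n whose binary logarithm lies between 16
  * \<open>fact k\<close> and 16 * \<open>fact (k + 1)\<close>. There a spacing of about n^(-1/8) is
  wanted: the mesh is fine enough to contain all its multiples in the interval, and that interval is
  still long enough to hold about n^(1/16) of them or more.\<close>

definition grid :: "nat \<Rightarrow> real set" where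
  "grid k = {x. \<exists>i :: nat. x = i / 2 ^ (2 * fact (k + 1)) \<and> x \<le> 1 / 2 ^ fact k}"

definition sparse_inputs :: "nat \<Rightarrow> real set" where
  "sparse_inputs b = (\<Union>k\<in>{k. k mod 2 = b}. grid k)"

lemma grid_subset: "grid k \<subseteq> {0..1 / 2 ^ fact k}"
  by (auto simp: grid_def)

lemma sparse_inputs_subset: "sparse_inputs b \<subseteq> {0..1}"
proof
  fix x assume "x \<in> sparse_inputs b"
  then obtain k where "x \<in> grid k" unfolding sparse_inputs_def by auto
  then have "0 \<le> x" "x \<le> 1 / 2 ^ fact k" using grid_subset[of k] by auto
  moreover have "1 / 2 ^ fact k \<le> (1::real)" by simp
  ultimately have "0 \<le> x \<and> x \<le> 1" by linarith
  then show "x \<in> {0..1}" by simp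
qed

lemma dyadic_refine:
  assumes "a \<le> b"
  shows "real i / 2 ^ a = real (i * 2 ^ (b - a)) / 2 ^ b"
proof -
  have "(2::real) ^ b = 2 ^ a * 2 ^ (b - a)" using assms by (simp flip: power_add)
  then show ?thesis by simp
qed

lemma zero_in_grid: "0 \<in> grid k"
  by (auto simp: grid_def intro!: exI[of _ 0])

lemma channel_sparse:
  assumes "b < 2"
  shows "channel (count_space (sparse_inputs b)) {0, 1, 2} bin2"
proof (rule channel_bin2[OF sparse_inputs_subset])
  have "b mod 2 = b" using assms by simp
  then show "sparse_inputs b \<noteq> {}"
    using zero_in_grid[of b] unfolding sparse_inputs_def by blast
qed

text \<open>Points of later grids are indistinguishable from 0, and earlier grids of the same parity stop
  at index k - 2, so they are contained in a grid of mesh 2 to the power - 2 * fact (k - 1).\<close>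
lemma DI_code_sparse_le:
  assumes k: "k mod 2 = b" "6 \<le> k"
    and code: "DI_code (count_space (sparse_inputs b)) {0, 1, 2} bin2 (2 ^ (fact k - 4)) N (1/4) (1/4)"
  shows "N \<le> 2 ^ ((2 * fact (k - 1) + 1) * 2 ^ (fact k - 4))"
proof -
  let ?n = "2 ^ (fact k - 4) :: nat" and ?J = "2 * fact (k - 1) :: nat"
  \<comment> \<open>Collapsing the interval up to 2^(-\<open>fact k\<close>) to the point 0 leaves
    only letters from the coarse grid \<open>R\<close>.\<close>
  define \<phi> where "\<phi> x = (if x \<le> 1 / 2 ^ fact k then 0 else x)" for x :: real
  define R where "R = (\<lambda>i :: nat. i / 2 ^ ?J :: real) ` {..2 ^ ?J}"
  have ch: "channel (count_space (sparse_inputs b)) {0, 1, 2} bin2"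
    using k by (intro channel_sparse) auto
  have "(fact 6 :: nat) \<le> fact k" by (rule fact_mono) (use k in auto)
  then have fk: "4 \<le> (fact k :: nat)" by (simp add: fact_numeral)
  have two: "(2::real) ^ fact k = 16 * ?n"
  proof -
    have "(2::real) ^ fact k = 2 ^ (4 + (fact k - 4))" using fk by simp
    then show ?thesis unfolding power_add by simp
  qed
  have "\<phi> x \<in> R" if "x \<in> sparse_inputs b" for x
  proof -
    from that obtain j where j: "j mod 2 = b" "x \<in> grid j" unfolding sparse_inputs_def by auto
    show ?thesis
    proof (cases "k \<le> j")
      case True
      have "(1::real) / 2 ^ fact j \<le> 1 / 2 ^ fact k"
        by (intro divide_left_mono power_increasing fact_mono True) auto
      then have "\<phi> x = 0" using grid_subset[of j] j by (auto simp: \<phi>_def)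
      then show ?thesis unfolding R_def by (auto intro!: image_eqI[of _ _ 0])
    next
      case False
      have "j + 1 \<noteq> k" using j k by presburger
      with False have "(fact (j + 1) :: nat) \<le> fact (k - 1)" by (intro fact_mono) simp
      then have le: "2 * fact (j + 1) \<le> ?J" by simp
      from j obtain i :: nat where "x = i / 2 ^ (2 * fact (j + 1))" by (auto simp: grid_def)
      then obtain m :: nat where m: "x = m / 2 ^ ?J" using dyadic_refine[OF le, of i] by blast
      have "x \<le> 1" using that sparse_inputs_subset by fastforce
      then have "real m \<le> 2 ^ ?J" using m by simp
      then have "m \<le> 2 ^ ?J" by (metis of_nat_le_iff of_nat_numeral of_nat_power)
      then have "x \<in> R" using m by (auto simp: R_def)
      moreover have "0 \<in> R" unfolding R_def by (auto intro!: image_eqI[of _ _ 0])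
      ultimately show ?thesis by (simp add: \<phi>_def)
    qed
  qed
  then have im: "\<phi> ` space (count_space (sparse_inputs b)) \<subseteq> R" by auto
  have close: "(\<Sum>a\<in>{0, 1, 2}. \<bar>bin2 x a - bin2 x' a\<bar>) \<le> 6 / 2 ^ fact k"
    if "x \<in> space (count_space (sparse_inputs b))" "x' \<in> space (count_space (sparse_inputs b))" "\<phi> x = \<phi> x'" for x x'
  proof -
    have x: "x \<in> {0..1}" "x' \<in> {0..1}" using that sparse_inputs_subset[of b] by auto
    have "(0::real) < 1 / 2 ^ fact k" by simp
    then have "\<bar>x - x'\<bar> \<le> 1 / 2 ^ fact k"
      using that(3) x by (auto simp: \<phi>_def split: if_splits)
    with bin2_L1_dist[OF x] show ?thesis by simp
  qed
  \<comment> \<open>Here \<delta> = 6 / 2^\<open>fact k\<close> and 2^\<open>fact k\<close> = 16 *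
    \<open>?n\<close>, so the total is 1/4 + 1/4 + 3/8 < 1; this is why the blocklength exponent is
    \<open>fact k - 4\<close>.\<close>
  have "N \<le> card R ^ ?n"
    by (rule DI_code_size_le[OF ch code _ im close]) (auto simp: R_def two)
  also have "card R \<le> 2 ^ (?J + 1)"
  proof -
    have "card R \<le> card {..(2::nat) ^ ?J}" unfolding R_def by (rule card_image_le) simp
    then show ?thesis using one_le_power[of "2::nat" ?J] by (simp only: card_atMost power_add power_one_right) linarith
  qed
  then have "card R ^ ?n \<le> (2 ^ (?J + 1)) ^ ?n" by (rule power_mono) simp
  finally show ?thesis by (simp only: power_mult)
qed

text \<open>Per letter a message carries at most 2 * \<open>fact (k - 1)\<close> + 1 bits, while log
  n = \<open>fact k - 4\<close> is at least (k - 1) * \<open>fact (k - 1)\<close>. Factorial growth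
  thus makes the ratio of order 1/k.\<close>

lemma DI_rate_sparse_le:
  assumes k: "k mod 2 = b" "6 \<le> k"
  shows "DI_rate (count_space (sparse_inputs b)) {0, 1, 2} bin2 (1/4) (1/4) (2 ^ (fact k - 4)) \<le> ereal (3 / real (k - 1))"
proof -
  let ?n = "2 ^ (fact k - 4) :: nat" and ?F = "fact (k - 1) :: nat"
  have F: "fact k = k * ?F" using k by (simp add: fact_reduce)
  have "(fact 5 :: nat) \<le> ?F" by (rule fact_mono) (use k in auto)
  then have F4: "4 \<le> ?F" by (simp add: fact_numeral)
  then have fk: "(k - 1) * ?F \<le> fact k - 4" "0 < (k - 1) * ?F"
    using k by (auto simp: F diff_mult_distrib)
  have "DI_rate (count_space (sparse_inputs b)) {0, 1, 2} bin2 (1/4) (1/4) ?n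
      \<le> ereal (log 2 (2 ^ ((2 * ?F + 1) * ?n)) / (real ?n * log 2 (real ?n)))"
  proof (rule DI_rate_le)
    fix N assume "DI_code (count_space (sparse_inputs b)) {0, 1, 2} bin2 ?n N (1/4) (1/4)"
    from DI_code_sparse_le[OF k this] show "real N \<le> 2 ^ ((2 * ?F + 1) * ?n)"
      by (metis of_nat_le_iff of_nat_numeral of_nat_power)
  qed simp
  also have "log 2 (2 ^ ((2 * ?F + 1) * ?n)) / (real ?n * log 2 (real ?n))
      = real ((2 * ?F + 1) * ?n) / (real ?n * real (fact k - 4))"
    by (simp only: of_nat_power of_nat_numeral log_nat_power log_pow_cancel) (simp add: log_pow_cancel)
  also have "\<dots> = real (2 * ?F + 1) / real (fact k - 4)"
    unfolding of_nat_mult mult.commute[of _ "real ?n"] by (rule mult_divide_mult_cancel_left) simp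
  also have "\<dots> \<le> real (3 * ?F) / real ((k - 1) * ?F)"
    by (intro frac_le) (use fk F4 in \<open>auto simp del: of_nat_mult simp: of_nat_le_iff\<close>)
  also have "\<dots> = 3 / real (k - 1)" using F4 by simp
  finally show ?thesis by simp
qed

text \<open>For the upper bound one pair of errors suffices, since the capacity is an infimum over
  errors, and one subsequence of blocklengths suffices for the limit inferior.\<close>

lemma C_DI_sparse:
  assumes "b < 2"
  shows "C_DI (count_space (sparse_inputs b)) {0, 1, 2} bin2 = 0"
proof (rule antisym)
  let ?rate = "DI_rate (count_space (sparse_inputs b)) {0, 1, 2} bin2 (1/4) (1/4)"
  \<comment> \<open>The index \<open>2 * j + 6 + b\<close> runs through numbers of parity
    \<open>b\<close> that are at least 6, as the rate bound requires.\<close>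
  define r where "r j = (2::nat) ^ (fact (2 * j + 6 + b) - 4)" for j
  have "strict_mono r"
  proof (rule strict_monoI_Suc)
    fix j
    have "(fact 6 :: nat) \<le> fact (2 * j + 6 + b)" by (rule fact_mono) auto
    then have "4 < (fact (2 * j + 6 + b) :: nat)" by (simp add: fact_numeral)
    moreover have "(fact (2 * j + 6 + b) :: nat) < fact (2 * Suc j + 6 + b)"
      by (rule fact_less_mono) auto
    ultimately show "r j < r (Suc j)" unfolding r_def by (intro power_strict_increasing) auto
  qed
  then have "liminf ?rate \<le> liminf (?rate \<circ> r)" by (rule liminf_subseq_mono)
  also have "\<dots> \<le> liminf (\<lambda>j. ereal (3 / real (Suc j)))"
  proof (intro Liminf_mono always_eventually allI)
    fix j
    have "?rate (r j) \<le> ereal (3 / real (2 * j + 6 + b - 1))"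
    proof -
      have "(2 * j + 6 + b) mod 2 = b" using assms by presburger
      from DI_rate_sparse_le[OF this] show ?thesis unfolding r_def by simp
    qed
    also have "\<dots> \<le> ereal (3 / real (Suc j))"
      unfolding ereal_less_eq by (intro divide_left_mono) auto
    finally show "(?rate \<circ> r) j \<le> ereal (3 / real (Suc j))" by simp
  qed
  also have "\<dots> = 0"
  proof -
    have "(\<lambda>j. 3 / real (Suc j)) \<longlonglongrightarrow> 0" by real_asymp
    then show ?thesis by (intro lim_imp_Liminf) (auto simp: zero_ereal_def)
  qed
  finally have "liminf ?rate \<le> 0" .
  then show "C_DI (count_space (sparse_inputs b)) {0, 1, 2} bin2 \<le> 0"
    unfolding C_DI_def by (rule INF_lower2[of "1/4", rotated, OF INF_lower2[of "1/4", rotated]]) auto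
qed (rule C_DI_nonneg[OF channel_sparse[OF assms]])

section \<open>A positive rate for the product channel\<close>

text \<open>Selects the grid for blocklengths near 2^l, as the least \<open>k\<close> satisfying the
  upper bound. The factor 16 places \<open>l div 8\<close> between 2 * \<open>fact k\<close> and 2 *
  \<open>fact (k + 1)\<close>; the hypothesis on \<open>l\<close> is the lower bound in the case
  \<open>k = 0\<close>.\<close>

lemma fact_bracket:
  fixes l :: nat
  assumes "16 \<le> l"
  obtains k where "16 * fact k \<le> l" "l < 16 * fact (k + 1)"
proof -
  have "l < 16 * fact (l + 1)" using fact_ge_self[of "l + 1"] by linarith
  then have ex: "\<exists>k. l < 16 * fact (k + 1)" by blast
  define k where "k = (LEAST k. l < 16 * fact (k + 1))"
  have "l < 16 * fact (k + 1)" unfolding k_def by (rule LeastI_ex[OF ex])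
  moreover have "16 * fact k \<le> l"
  proof (cases k)
    case (Suc m)
    then have "\<not> l < 16 * fact (m + 1)" unfolding k_def by (intro not_less_Least) simp
    then show ?thesis using Suc by simp
  qed (use assms in simp)
  ultimately show ?thesis using that by blast
qed

text \<open>With n between 2 to the powers l and l + 1, the letters are multiples of 2 to the power -p,
  where p = l div 8; this spacing exceeds the resolution n to the power -1/4 of the score.\<close>
lemma DI_rate_grid_ge:
  assumes "0 < l1" "0 < l2"
  shows "eventually (\<lambda>n. \<exists>k. \<forall>A. grid k \<subseteq> A \<longrightarrow> A \<subseteq> {0..1} \<longrightarrow>
           ereal (1/64) \<le> DI_rate (count_space A) {0, 1, 2} bin2 l1 l2 n) sequentially"
proof -
  define \<epsilon> where "\<epsilon> = min l1 l2"
  have "\<epsilon> > 0" using assms by (simp add: \<epsilon>_def)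
  have "eventually (\<lambda>n. (16 / \<epsilon>)\<^sup>2 \<le> real n) sequentially"
    by real_asymp
  then show ?thesis using eventually_ge_at_top[of "2 ^ 79"]
  proof eventually_elim
    case (elim n)
    have "1 \<le> n" using elim(2) one_le_power[of "2::nat" 79] by linarith
    obtain l where l: "2 ^ l \<le> n" "n < 2 ^ (l + 1)"
      using ex_power_ivl1[of 2 n] \<open>1 \<le> n\<close> by auto
    have "(2::nat) ^ 79 < 2 ^ (l + 1)" using elim(2) l(2) by (rule le_less_trans)
    then have "79 < l + 1" by (rule power_less_imp_less_exp[rotated]) simp
    then have l79: "79 \<le> l" by simp
    obtain k where k: "16 * fact k \<le> l" "l < 16 * fact (k + 1)"
      by (rule fact_bracket[of l]) (use l79 that in auto)
    define p where "p = l div 8"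
    \<comment> \<open>The 2^m multiples of 2^(-p) in \<open>Q\<close> stay within the interval of
      \<open>grid k\<close>, and 2 * \<open>fact k\<close> \<le> \<open>p\<close> gives
      \<open>m\<close> \<ge> p / 2, so \<open>Q\<close> is polynomially large in
      \<open>n\<close>.\<close>
    define m where "m = p - fact k"
    have p: "2 * fact k \<le> p" "p \<le> 2 * fact (k + 1)" using k by (auto simp: p_def)
    define Q where "Q = (\<lambda>i::nat. real i / 2 ^ p) ` {..<2 ^ m}"
    have inj: "inj_on (\<lambda>i::nat. real i / 2 ^ p) {..<2 ^ m}" by (auto simp: inj_on_def)
    have cardQ: "card Q = 2 ^ m" unfolding Q_def by (simp add: card_image[OF inj])
    have Qgrid: "Q \<subseteq> grid k"
    proof
      fix x assume "x \<in> Q"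
      then obtain i where i: "i < 2 ^ m" "x = real i / 2 ^ p" by (auto simp: Q_def)
      have "real i \<le> 2 ^ m" using i(1) by (metis less_imp_le of_nat_le_iff of_nat_numeral of_nat_power)
      then have "x \<le> 2 ^ m / 2 ^ p" unfolding i(2) by (intro divide_right_mono) auto
      also have "(2::real) ^ p = 2 ^ m * 2 ^ fact k" using p by (simp add: m_def flip: power_add)
      finally have "x \<le> 1 / 2 ^ fact k" by simp
      moreover have "x = real (i * 2 ^ (2 * fact (k + 1) - p)) / 2 ^ (2 * fact (k + 1))"
        unfolding i(2) by (rule dyadic_refine[OF p(2)])
      ultimately show "x \<in> grid k" unfolding grid_def by blast
    qed
    have sep: "1 / 2 ^ p \<le> \<bar>a - b\<bar>" if ab: "a \<in> Q" "b \<in> Q" "a \<noteq> b" for a b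
    proof -
      from ab obtain i j :: nat where ij: "a = real i / 2 ^ p" "b = real j / 2 ^ p" by (auto simp: Q_def)
      have "1 \<le> \<bar>real i - real j\<bar>" using ab(3) ij by (cases i j rule: linorder_cases) auto
      then have "1 / 2 ^ p \<le> \<bar>real i - real j\<bar> / 2 ^ p" by (intro divide_right_mono) auto
      also have "\<dots> = \<bar>a - b\<bar>" unfolding ij by (simp add: abs_divide flip: diff_divide_distrib)
      finally show ?thesis .
    qed
    \<comment> \<open>With spacing s = 2^(-p), 8 * p \<le> l yields s^4 \<ge> 1 / sqrt n, so the
      Chebyshev bound is at most 16 / sqrt n, which the first condition on \<open>n\<close> makes at
      most \<open>\<epsilon>\<close>.\<close>
    have err: "16 / (n * (1 / 2 ^ p) ^ 4) \<le> \<epsilon>"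
    proof -
      have "((2::real) ^ (4 * p))\<^sup>2 = 2 ^ (8 * p)" by (simp flip: power_mult)
      also have "\<dots> \<le> 2 ^ l" by (rule power_increasing) (auto simp: p_def)
      also have "\<dots> \<le> real n" using l(1) by (metis of_nat_le_iff of_nat_numeral of_nat_power)
      finally have "2 ^ (4 * p) \<le> sqrt n" by (simp add: real_le_rsqrt)
      moreover have "16 / \<epsilon> \<le> sqrt n" using elim(1) by (rule real_le_rsqrt)
      ultimately have "2 ^ (4 * p) * (16 / \<epsilon>) \<le> sqrt n * sqrt n"
        using \<open>\<epsilon> > 0\<close> by (intro mult_mono) auto
      then have "2 ^ (4 * p) * 16 \<le> \<epsilon> * n" using \<open>\<epsilon> > 0\<close> by (simp add: field_simps)
      moreover have "16 / (n * (1 / 2 ^ p) ^ 4) = 2 ^ (4 * p) * 16 / n"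
        by (simp add: power_divide power_mult[symmetric] mult.commute)
      ultimately show ?thesis using \<open>1 \<le> n\<close> by (simp add: field_simps)
    qed
    show ?case
    proof (intro exI[of _ k] allI impI)
      fix A assume A: "grid k \<subseteq> A" "A \<subseteq> {0..1}"
      have "Q \<noteq> {}" unfolding Q_def by (auto simp: lessThan_empty_iff)
      obtain N where N: "DI_code (count_space A) {0, 1, 2} bin2 n N l1 l2"
        "card Q ^ n \<le> N * (2 ^ n * card Q ^ (n div 2))"
        by (rule DI_code_bin2[OF A(2) _ \<open>Q \<noteq> {}\<close> _ sep, of n l1 l2])
          (use that A Qgrid \<open>1 \<le> n\<close> err in \<open>auto simp: Q_def \<epsilon>_def\<close>)
      have "0 < card Q ^ n" by (simp add: cardQ)
      with N(2) have N1: "1 \<le> N" by (cases N) auto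
      have "real (card Q ^ n) \<le> real (N * (2 ^ n * card Q ^ (n div 2)))"
        using N(2) by (simp only: of_nat_le_iff)
      \<comment> \<open>In logarithms the code bound reads m * n \<le> log N + n + m * (n div 2),
        that is, log N is at least n * (m / 2 - 1).\<close>
      then have "(2::real) ^ (m * n) \<le> real N * 2 ^ (n + m * (n div 2))"
        by (simp add: cardQ power_mult power_add)
      then have "log 2 (2 ^ (m * n)) \<le> log 2 (real N * 2 ^ (n + m * (n div 2)))"
        using N1 by (subst log_le_cancel_iff) auto
      also have "\<dots> = log 2 N + log 2 (2 ^ (n + m * (n div 2)))"
        using N1 by (simp add: log_mult)
      finally have "real (m * n) \<le> log 2 N + real (n + m * (n div 2))"
        by (simp only: log_pow_cancel)
      moreover have "real (m * (n div 2)) \<le> m * (n / 2)"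
        unfolding of_nat_mult by (intro mult_left_mono) linarith+
      ultimately have N_ge: "n * (m / 2 - 1) \<le> log 2 N" by (simp add: algebra_simps)
      \<comment> \<open>The claim amounts to l + 65 \<le> 32 * m. From 2 * m \<ge> p and 8 * p \<ge>
        l - 7 follows 32 * m \<ge> 2 * l - 14, which reaches l + 65 once l \<ge> 79; hence the
        threshold 2^79 on \<open>n\<close>.\<close>
      have m_ge: "(real l + 1) / 64 \<le> m / 2 - 1"
      proof -
        have "l + 65 \<le> 32 * m" using p(1) l79 unfolding m_def p_def by linarith
        then show ?thesis using l79 by simp
      qed
      have log_n: "log 2 n \<le> real l + 1"
      proof -
        have "real n \<le> 2 ^ (l + 1)" using l(2) by (metis less_imp_le of_nat_le_iff of_nat_numeral of_nat_power)
        then have "log 2 n \<le> log 2 (2 ^ (l + 1))" using \<open>1 \<le> n\<close> by (subst log_le_cancel_iff) auto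
        then show ?thesis by (simp only: log_pow_cancel of_nat_add of_nat_1)
      qed
      have "log 2 n / 64 \<le> (real l + 1) / 64" by (rule divide_right_mono[OF log_n]) simp
      from order_trans[OF this m_ge]
      have "n * (log 2 n / 64) \<le> n * (m / 2 - 1)" by (rule mult_left_mono) simp
      with N_ge have "n * (log 2 n / 64) \<le> log 2 N" by (rule order_trans[rotated])
      moreover have "0 < log 2 (real n)"
      proof -
        have "2 ^ 1 \<le> (2::nat) ^ 79" by (rule power_increasing) auto
        from order_trans[OF this elim(2)] have "1 < n" by simp
        then show ?thesis by simp
      qed
      ultimately have "1 / 64 \<le> log 2 N / (n * log 2 n)"
        using \<open>1 \<le> n\<close> by (simp add: field_simps)
      then have "ereal (1/64) \<le> ereal (log 2 N / (n * log 2 n))" by simp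
      also have "\<dots> \<le> DI_rate (count_space A) {0, 1, 2} bin2 l1 l2 n"
        by (rule DI_rate_ge[OF N(1) N1])
      finally show "ereal (1/64) \<le> DI_rate (count_space A) {0, 1, 2} bin2 l1 l2 n" .
    qed
  qed
qed

text \<open>Superadditivity of capacities would give only 0 here, so the rates are added at each
  blocklength before the limit inferior is taken. The parity of the selected \<open>k\<close>
  decides which factor has rate at least 1/64, and the other rate is nonnegative.\<close>

lemma C_DI_prod_sparse_ge:
  "ereal (1/64) \<le> C_DI (count_space (sparse_inputs 0) \<Otimes>\<^sub>M count_space (sparse_inputs 1))
     ({0, 1, 2} \<times> {0, 1, 2}) (prod_channel bin2 bin2)"
  unfolding C_DI_def
proof (intro INF_greatest Liminf_bounded)
  fix l1 l2 :: real assume l: "l1 \<in> {0<..}" "l2 \<in> {0<..}"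
  let ?r = "\<lambda>b. DI_rate (count_space (sparse_inputs b)) {0, 1, 2} bin2 (l1/2) l2"
  let ?r01 = "DI_rate (count_space (sparse_inputs 0) \<Otimes>\<^sub>M count_space (sparse_inputs 1))
     ({0, 1, 2} \<times> {0, 1, 2}) (prod_channel bin2 bin2) l1 l2"
  have "eventually (\<lambda>n. \<exists>k. \<forall>A. grid k \<subseteq> A \<longrightarrow> A \<subseteq> {0..1} \<longrightarrow>
           ereal (1/64) \<le> DI_rate (count_space A) {0, 1, 2} bin2 (l1/2) l2 n) sequentially"
    by (rule DI_rate_grid_ge) (use l in auto)
  then show "eventually (\<lambda>n. ereal (1/64) \<le> ?r01 n) sequentially"
  proof eventually_elim
    case (elim n)
    then obtain k where k: "\<And>A. grid k \<subseteq> A \<Longrightarrow> A \<subseteq> {0..1} \<Longrightarrow>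
        ereal (1/64) \<le> DI_rate (count_space A) {0, 1, 2} bin2 (l1/2) l2 n" by blast
    have "ereal (1/64) \<le> ?r (k mod 2) n"
      by (rule k[OF _ sparse_inputs_subset]) (auto simp: sparse_inputs_def)
    moreover have "0 \<le> ?r 0 n" "0 \<le> ?r 1 n"
      using l by (intro DI_rate_nonneg[OF channel_sparse]; simp)+
    ultimately have "ereal (1/64) \<le> ?r 0 n + ?r 1 n"
      by (cases "k mod 2 = 0") (auto intro: add_increasing add_increasing2 simp: mod2_eq_if split: if_splits)
    also have "\<dots> \<le> ?r01 n"
      using DI_rate_prod[OF channel_sparse[of 0] channel_sparse[of 1], of "l1/2" l2 n] l by simp
    finally show ?case .
  qed
qed

theorem theorem9:
  shows "(\<forall>(M1 :: 'x1 measure) (Y1 :: 'y1 set) W1 (M2 :: 'x2 measure) (Y2 :: 'y2 set) W2.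
            channel M1 Y1 W1 \<longrightarrow> channel M2 Y2 W2 \<longrightarrow>
            C_DI (M1 \<Otimes>\<^sub>M M2) (Y1 \<times> Y2) (prod_channel W1 W2) \<ge> C_DI M1 Y1 W1 + C_DI M2 Y2 W2)
       \<and> (\<exists>(M1 :: real measure) (Y1 :: nat set) W1 (M2 :: real measure) (Y2 :: nat set) W2.
            channel M1 Y1 W1 \<and> channel M2 Y2 W2 \<and>
            C_DI M1 Y1 W1 = 0 \<and> C_DI M2 Y2 W2 = 0 \<and>
            C_DI (M1 \<Otimes>\<^sub>M M2) (Y1 \<times> Y2) (prod_channel W1 W2) > 0)"
proof (rule conjI)
  show "\<exists>(M1 :: real measure) (Y1 :: nat set) W1 (M2 :: real measure) (Y2 :: nat set) W2.
            channel M1 Y1 W1 \<and> channel M2 Y2 W2 \<and>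
            C_DI M1 Y1 W1 = 0 \<and> C_DI M2 Y2 W2 = 0 \<and>
            C_DI (M1 \<Otimes>\<^sub>M M2) (Y1 \<times> Y2) (prod_channel W1 W2) > 0"
  proof (intro exI conjI)
    show "channel (count_space (sparse_inputs 0)) {0, 1, 2} bin2"
      "channel (count_space (sparse_inputs 1)) {0, 1, 2} bin2"
      by (rule channel_sparse, simp)+
    show "C_DI (count_space (sparse_inputs 0)) {0, 1, 2} bin2 = 0"
      "C_DI (count_space (sparse_inputs 1)) {0, 1, 2} bin2 = 0"
      by (rule C_DI_sparse, simp)+
    show "0 < C_DI (count_space (sparse_inputs 0) \<Otimes>\<^sub>M count_space (sparse_inputs 1))
       ({0, 1, 2} \<times> {0, 1, 2}) (prod_channel bin2 bin2)"
      by (rule less_le_trans[OF _ C_DI_prod_sparse_ge]) simp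
  qed
qed (blast intro: C_DI_superadditive)

end
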